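(* Let 2 players $A,B$ divide 2 cakes, where the first cake is cut into $k_1\ge 2$ pieces and the second into $k_2\ge 3$ pieces, and let the players have preferences $\mathrm{Pref}_A,\mathrm{Pref}_B$ satisfying the assumptions described in the context. Then there exist a division $x$ and disjoint piece selections $s_A\in\mathrm{Pref}_A(x)$, $s_B\in\mathrm{Pref}_B(x)$ (disjoint envy-free piece selections).
   Context: Model of multi-cake division. There are $m$ cakes, each of length $1$, and cake $i$ is cut into $k_i$ pieces. A division is a family $x=(x_{ij})_{1\le i\le m,\,1\le j\le k_i}$ with $x_{ij}\ge 0$ and $\sum_{j=1}^{k_i} x_{ij}=1$ for every $i$; $x_{ij}$ is the length of the $j$-th piece of cake $i$. A piece selection is a choice of one piece from each cake, i.e. a map $s$ with $s(i)\in\{1,\dots,k_i\}$. Two piece selections $s,s'$ are disjoint if $s(i)\ne s'(i)$ for every cake $i$. Each player has preferences given by assigning to every division $x$ a nonempty set $\mathrm{Pref}(x)$ of preferred piece selections (those not worse than any other at $x$ for that player); each player's preferences depend only on that player. Assumptions: (hungry) no $s\in\mathrm{Pref}(x)$ contains an empty piece, i.e. $x_{i,s(i)}>0$ for all $i$ (a player prefers a nonempty piece in a cake to an empty piece in that cake, other cakes fixed); (closed) for each piece selection $s$ the set of divisions $x$ with $s\in\mathrm{Pref}(x)$ is closed. *)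

theory Defs
  imports "HOL-Analysis.Analysis"
begin

text \<open>
  Cakes are indexed by \<open>{1..m}\<close> and the pieces of cake \<open>i\<close> by \<open>{1..k i}\<close>. A division is a
  function \<open>nat \<Rightarrow> nat \<Rightarrow> real\<close> set to zero outside the index range, so that a division is
  determined by its finitely many meaningful entries. On such functions the product topology
  of \<open>nat \<Rightarrow> nat \<Rightarrow> real\<close> is the usual Euclidean topology.
\<close>

definition divisions :: "nat \<Rightarrow> (nat \<Rightarrow> nat) \<Rightarrow> (nat \<Rightarrow> nat \<Rightarrow> real) set" where
  "divisions m k =
     {x. (\<forall>i\<in>{1..m}. (\<forall>j\<in>{1..k i}. 0 \<le> x i j) \<and> (\<Sum>j=1..k i. x i j) = 1) \<and>
         (\<forall>i j. \<not> (i \<in> {1..m} \<and> j \<in> {1..k i}) \<longrightarrow> x i j = 0)}"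

definition piece_selections :: "nat \<Rightarrow> (nat \<Rightarrow> nat) \<Rightarrow> (nat \<Rightarrow> nat) set" where
  "piece_selections m k = (\<Pi>\<^sub>E i\<in>{1..m}. {1..k i})"

definition disjoint_selections :: "nat \<Rightarrow> (nat \<Rightarrow> nat) \<Rightarrow> (nat \<Rightarrow> nat) \<Rightarrow> bool" where
  "disjoint_selections m s s' \<longleftrightarrow> (\<forall>i\<in>{1..m}. s i \<noteq> s' i)"

text \<open>Values of a preference function at arguments that are not divisions are irrelevant.\<close>

definition preferences ::
    "nat \<Rightarrow> (nat \<Rightarrow> nat) \<Rightarrow> ((nat \<Rightarrow> nat \<Rightarrow> real) \<Rightarrow> (nat \<Rightarrow> nat) set) \<Rightarrow> bool" where
  "preferences m k Pref \<longleftrightarrow>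
     (\<forall>x\<in>divisions m k. Pref x \<noteq> {} \<and> Pref x \<subseteq> piece_selections m k)"

definition hungry ::
    "nat \<Rightarrow> (nat \<Rightarrow> nat) \<Rightarrow> ((nat \<Rightarrow> nat \<Rightarrow> real) \<Rightarrow> (nat \<Rightarrow> nat) set) \<Rightarrow> bool" where
  "hungry m k Pref \<longleftrightarrow>
     (\<forall>x\<in>divisions m k. \<forall>s\<in>Pref x. \<forall>i\<in>{1..m}. 0 < x i (s i))"

definition closed_preferences ::
    "nat \<Rightarrow> (nat \<Rightarrow> nat) \<Rightarrow> ((nat \<Rightarrow> nat \<Rightarrow> real) \<Rightarrow> (nat \<Rightarrow> nat) set) \<Rightarrow> bool" where
  "closed_preferences m k Pref \<longleftrightarrow>
     (\<forall>s\<in>piece_selections m k.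
        closedin (top_of_set (divisions m k)) {x \<in> divisions m k. s \<in> Pref x})"

end

theory Submission
  imports Defs
begin

text \<open>
  Pieces beyond \<open>2\<close> of the first cake and \<open>3\<close> of the second are kept empty, which hungry
  players never select. Suppose no disjoint envy-free selections exist. Each player's closed
  preference sets then admit continuous weights on the piece selections, such that disjoint
  selections never carry weight of \<open>A\<close> and of \<open>B\<close> at the same division. Averaging both players'
  weights and taking marginals gives a continuous self-map of the divisions that maps every face
  into itself, hence is onto by Brouwer's theorem. At a division that is mapped to
  \<open>(1/2, 1/2; 1/3, 1/3, 1/3)\<close>, the marginals force two disjoint selections with positive weight.
\<close>

section \<open>Divisions as a closed set in a product space\<close>

lemma continuous_on_entry [continuous_intros]:
  fixes S :: "('a \<Rightarrow> 'b \<Rightarrow> 'c::topological_space) set"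
  shows "continuous_on S (\<lambda>x. x i j)"
  by (rule continuous_on_product_then_coordinatewise
      [OF continuous_on_product_then_coordinatewise[OF continuous_on_id]])

lemma divisionsD:
  assumes "x \<in> divisions m q"
  shows "0 \<le> x i j"
    and "i \<in> {1..m} \<Longrightarrow> (\<Sum>j=1..q i. x i j) = 1"
    and "\<not> (i \<in> {1..m} \<and> j \<in> {1..q i}) \<Longrightarrow> x i j = 0"
proof -
  have *: "(\<forall>i\<in>{1..m}. (\<forall>j\<in>{1..q i}. 0 \<le> x i j) \<and> (\<Sum>j=1..q i. x i j) = 1) \<and>
      (\<forall>i j. \<not> (i \<in> {1..m} \<and> j \<in> {1..q i}) \<longrightarrow> x i j = 0)"
    using assms by (simp only: divisions_def mem_Collect_eq)
  show "x i j = 0" if "\<not> (i \<in> {1..m} \<and> j \<in> {1..q i})"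
    using * that by simp
  show "0 \<le> x i j"
    using * by (cases "i \<in> {1..m} \<and> j \<in> {1..q i}") simp_all
  show "(\<Sum>j=1..q i. x i j) = 1" if "i \<in> {1..m}"
    using * that by simp
qed

lemma divisionsI:
  assumes "\<And>i j. 0 \<le> x i j"
    and "\<And>i. i \<in> {1..m} \<Longrightarrow> (\<Sum>j=1..q i. x i j) = 1"
    and "\<And>i j. \<not> (i \<in> {1..m} \<and> j \<in> {1..q i}) \<Longrightarrow> x i j = 0"
  shows "x \<in> divisions m q"
  using assms by (simp add: divisions_def)

lemma divisions_le_1:
  assumes "x \<in> divisions m q"
  shows "x i j \<le> 1"
proof (cases "i \<in> {1..m} \<and> j \<in> {1..q i}")
  case True
  then have "x i j \<le> (\<Sum>j=1..q i. x i j)"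
    by (intro member_le_sum) (auto simp: divisionsD(1)[OF assms])
  then show ?thesis
    using divisionsD(2)[OF assms] True by simp
qed (simp add: divisionsD(3)[OF assms])

lemma closed_divisions: "closed (divisions m q)"
  unfolding divisions_def Ball_def
  by (intro closed_Collect_conj closed_Collect_all closed_Collect_imp open_Collect_const
      closed_Collect_le closed_Collect_eq continuous_intros)

text \<open>Since divisions vanish outside their index range, cutting a cake into fewer pieces is
  the same as leaving the surplus pieces empty. This lets an argument with few pieces speak about
  players who see all of them.\<close>

lemma divisions_mono:
  assumes "\<And>i. i \<in> {1..m} \<Longrightarrow> q i \<le> k i"
  shows "divisions m q \<subseteq> divisions m k"
proof
  fix x assume x: "x \<in> divisions m q"
  show "x \<in> divisions m k"
  proof (rule divisionsI)
    fix i assume i: "i \<in> {1..m}"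
    have "(\<Sum>j=1..k i. x i j) = (\<Sum>j=1..q i. x i j)"
      by (rule sum.mono_neutral_right) (use assms[OF i] divisionsD(3)[OF x] in auto)
    then show "(\<Sum>j=1..k i. x i j) = 1"
      using divisionsD(2)[OF x i] by simp
  next
    fix i j assume "\<not> (i \<in> {1..m} \<and> j \<in> {1..k i})"
    then show "x i j = 0"
      using divisionsD(3)[OF x, of i j] assms[of i] by fastforce
  qed (rule divisionsD(1)[OF x])
qed

section \<open>Brouwer's theorem and surjectivity of face-preserving maps\<close>

text \<open>The index type \<open>'n\<close> only serves to embed the divisions into some Euclidean space.\<close>

lemma brouwer_divisions:
  assumes card: "card (Sigma {1..m} (\<lambda>i. {1..q i})) = CARD('n::finite)"
    and cont: "continuous_on (divisions m q) h"
    and maps: "h \<in> divisions m q \<rightarrow> divisions m q"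
    and ne: "divisions m q \<noteq> {}"
  obtains x where "x \<in> divisions m q" and "h x = x"
proof -
  let ?S = "Sigma {1..m} (\<lambda>i. {1..q i})"
  obtain pos where pos: "bij_betw pos (UNIV :: 'n set) ?S"
    using finite_same_card_bij[OF finite, of ?S] card by force
  define idx where "idx = inv pos"
  have inj: "inj pos" and ran: "range pos = ?S"
    using pos by (auto simp: bij_betw_def)
  have idx_pos: "idx (pos n) = n" for n
    using inj by (simp add: idx_def)
  have pos_idx: "pos (idx s) = s" if "s \<in> ?S" for s
    using that ran by (simp add: idx_def f_inv_into_f)
  define emb :: "real^'n \<Rightarrow> nat \<Rightarrow> nat \<Rightarrow> real" where
    "emb v = (\<lambda>i j. if (i, j) \<in> ?S then v $ idx (i, j) else 0)" for v
  define ret :: "(nat \<Rightarrow> nat \<Rightarrow> real) \<Rightarrow> real^'n" where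
    "ret x = (\<chi> n. x (fst (pos n)) (snd (pos n)))" for x
  \<comment> \<open>\<open>K\<close> is a copy of the divisions in Euclidean space. Taking it as a
    preimage under the continuous map \<open>emb\<close> yields closedness from
    \<open>closed_divisions\<close>, while \<open>emb\<close> being linear yields convexity.\<close>
  define K where "K = {v. emb v \<in> divisions m q}"
  have emb_ret: "emb (ret x) = x" if "x \<in> divisions m q" for x
    using divisionsD(3)[OF that] by (auto simp: emb_def ret_def pos_idx fun_eq_iff)
  have ret_emb: "ret (emb v) = v" for v
  proof -
    have "pos n \<in> ?S" for n
      using ran by blast
    then show ?thesis
      by (simp only: emb_def ret_def vec_lambda_beta prod.collapse idx_pos if_True vec_eq_iff simp_thms)
  qed
  have cemb: "continuous_on T emb" for T
  proof (intro continuous_on_coordinatewise_then_product)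
    fix i j show "continuous_on T (\<lambda>v. emb v i j)"
      by (cases "(i, j) \<in> ?S") (auto simp: emb_def intro!: continuous_intros)
  qed
  have cret: "continuous_on T ret" for T
    unfolding ret_def by (intro continuous_intros)
  have "closed K"
    using continuous_closed_vimage[OF closed_divisions, of emb m q] cemb[of UNIV]
    by (simp add: K_def vimage_def continuous_on_eq_continuous_at)
  moreover have "K \<subseteq> cbox 0 1"
  proof
    fix v assume "v \<in> K"
    then have v: "emb v \<in> divisions m q" by (simp add: K_def)
    have "0 \<le> v $ n \<and> v $ n \<le> 1" for n
    proof -
      have "v $ n = emb v (fst (pos n)) (snd (pos n))"
        using ret_emb[of v] by (metis ret_def vec_lambda_beta)
      then show ?thesis
        using divisionsD(1)[OF v] divisions_le_1[OF v] by simp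
    qed
    then show "v \<in> cbox 0 1" by (simp add: mem_box_cart)
  qed
  ultimately have "compact K"
    by (meson bounded_cbox bounded_subset compact_eq_bounded_closed)
  moreover have "convex K"
  proof (rule convexI)
    fix v w and a b :: real
    assume vw: "v \<in> K" "w \<in> K" and ab: "0 \<le> a" "0 \<le> b" "a + b = 1"
    have v: "emb v \<in> divisions m q" and w: "emb w \<in> divisions m q"
      using vw by (auto simp: K_def)
    have eq: "emb (a *\<^sub>R v + b *\<^sub>R w) i j = a * emb v i j + b * emb w i j" for i j
      by (simp add: emb_def)
    have "emb (a *\<^sub>R v + b *\<^sub>R w) \<in> divisions m q"
    proof (rule divisionsI)
      show "0 \<le> emb (a *\<^sub>R v + b *\<^sub>R w) i j" for i j
        unfolding eq using ab divisionsD(1)[OF v] divisionsD(1)[OF w] by simp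
      show "(\<Sum>j=1..q i. emb (a *\<^sub>R v + b *\<^sub>R w) i j) = 1" if "i \<in> {1..m}" for i
        unfolding eq using ab divisionsD(2)[OF v that] divisionsD(2)[OF w that]
        by (simp add: sum.distrib flip: sum_distrib_left)
      show "emb (a *\<^sub>R v + b *\<^sub>R w) i j = 0" if "\<not> (i \<in> {1..m} \<and> j \<in> {1..q i})" for i j
        unfolding eq using divisionsD(3)[OF v that] divisionsD(3)[OF w that] by simp
    qed
    then show "a *\<^sub>R v + b *\<^sub>R w \<in> K" by (simp add: K_def)
  qed
  moreover have "K \<noteq> {}"
    proof -
    obtain x where "x \<in> divisions m q" using ne by blast
    then have "ret x \<in> K" by (simp add: K_def emb_ret)
    then show ?thesis by blast
  qed
  moreover have "continuous_on K (\<lambda>v. ret (h (emb v)))"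
  proof -
    have "emb ` K \<subseteq> divisions m q"
      by (auto simp: K_def)
    then have "continuous_on K (\<lambda>v. h (emb v))"
      by (rule continuous_on_compose2[OF cont cemb])
    then show ?thesis
      by (rule continuous_on_compose2[OF cret[of UNIV]]) simp
  qed
  moreover have "(\<lambda>v. ret (h (emb v))) \<in> K \<rightarrow> K"
  proof
    fix v assume "v \<in> K"
    then have "h (emb v) \<in> divisions m q" using maps by (auto simp: K_def)
    then show "ret (h (emb v)) \<in> K" by (simp add: K_def emb_ret)
  qed
  ultimately obtain v where v: "v \<in> K" "ret (h (emb v)) = v"
    by (rule brouwer)
  have ev: "emb v \<in> divisions m q" using v by (simp add: K_def)
  then have "h (emb v) \<in> divisions m q" using maps by blast
  from emb_ret[OF this] have "h (emb v) = emb v" unfolding v(2) by simp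
  with ev show thesis by (rule that)
qed

text \<open>Move \<open>x\<close> towards those pieces on which \<open>g x\<close> falls short of
  \<open>p\<close> and rescale each cake to length 1; Brouwer gives a fixed point of this move. At
  the fixed point no piece can be short: otherwise, in some cake, every nonempty piece would be
  short, while on the empty ones \<open>g x\<close> is 0 by the face condition, so
  \<open>g x\<close> would have total length below 1 in that cake.\<close>

lemma face_preserving_surj:
  assumes card: "card (Sigma {1..m} (\<lambda>i. {1..q i})) = CARD('n::finite)"
    and cont: "continuous_on (divisions m q) g"
    and maps: "g \<in> divisions m q \<rightarrow> divisions m q"
    and face: "\<And>x i j. x \<in> divisions m q \<Longrightarrow> x i j = 0 \<Longrightarrow> g x i j = 0"
    and p: "p \<in> divisions m q"
  obtains x where "x \<in> divisions m q" and "g x = p"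
proof -
  \<comment> \<open>\<open>d x i j\<close> is the shortfall of a piece and \<open>T x i\<close> the
    total shortfall in cake \<open>i\<close>. The denominator \<open>1 + T x i\<close> is at least 1
    and restores the length of the cake.\<close>
  define d where "d x i j = max 0 (p i j - g x i j)" for x i j
  define T where "T x i = (\<Sum>j=1..q i. d x i j)" for x i
  define h where "h x = (\<lambda>i j. (x i j + d x i j) / (1 + T x i))" for x
  have d0: "0 \<le> d x i j" for x i j by (simp add: d_def)
  have T0: "0 \<le> T x i" for x i unfolding T_def by (intro sum_nonneg d0)
  have contg: "continuous_on (divisions m q) (\<lambda>x. g x i j)" for i j
    by (rule continuous_on_product_then_coordinatewise
        [OF continuous_on_product_then_coordinatewise[OF cont]])
  have "continuous_on (divisions m q) h"
    unfolding h_def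
  proof (intro continuous_on_coordinatewise_then_product)
    fix i j
    have "1 + T x i \<noteq> 0" for x using T0[of x i] by simp
    then show "continuous_on (divisions m q) (\<lambda>x. (x i j + d x i j) / (1 + T x i))"
      unfolding T_def d_def by (intro continuous_intros contg) auto
  qed
  moreover have "h \<in> divisions m q \<rightarrow> divisions m q"
  proof
    fix x assume x: "x \<in> divisions m q"
    then have gx: "g x \<in> divisions m q" using maps by blast
    show "h x \<in> divisions m q"
    proof (rule divisionsI)
      show "0 \<le> h x i j" for i j
        unfolding h_def using d0 T0 divisionsD(1)[OF x] by (simp add: add_nonneg_nonneg)
      show "(\<Sum>j=1..q i. h x i j) = 1" if "i \<in> {1..m}" for i
      proof -
        have "(\<Sum>j=1..q i. h x i j) = (1 + T x i) / (1 + T x i)"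
          unfolding h_def using divisionsD(2)[OF x that]
          by (simp add: T_def sum.distrib flip: sum_divide_distrib)
        then show ?thesis using T0[of x i] by simp
      qed
      show "h x i j = 0" if "\<not> (i \<in> {1..m} \<and> j \<in> {1..q i})" for i j
        using divisionsD(3)[OF x that] divisionsD(3)[OF p that] divisionsD(3)[OF gx that]
        by (simp add: h_def d_def)
    qed
  qed
  ultimately obtain x where x: "x \<in> divisions m q" "h x = x"
    by (rule brouwer_divisions[OF card]) (use p in auto)
  have gx: "g x \<in> divisions m q" using maps x by blast
  have fixed: "x i j * T x i = d x i j" for i j
  proof -
    have "(x i j + d x i j) / (1 + T x i) = x i j"
      using fun_cong[OF fun_cong[OF x(2), of i], of j] by (simp only: h_def)
    then show ?thesis
      using T0[of x i] by (simp add: field_simps)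
  qed
  \<comment> \<open>If \<open>T x i\<close> is positive, \<open>fixed\<close> makes the shortfall
    proportional to \<open>x i j\<close>, so it is strict exactly on the nonempty pieces.\<close>
  have T_zero: "T x i = 0" if i: "i \<in> {1..m}" for i
  proof (rule ccontr)
    assume "T x i \<noteq> 0"
    then have Tpos: "0 < T x i" using T0[of x i] by simp
    have less: "g x i j < p i j" if "0 < x i j" for j
      using fixed[of i j] mult_pos_pos[OF that Tpos] by (simp add: d_def)
    have le: "g x i j \<le> p i j" for j
      using less[of j] face[OF x(1), of i j] divisionsD(1)[OF x(1), of i j]
        divisionsD(1)[OF p, of i j] by fastforce
    obtain j where j: "j \<in> {1..q i}" "x i j \<noteq> 0"
    proof -
      have "\<exists>j\<in>{1..q i}. x i j \<noteq> 0"
      proof (rule ccontr)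
        assume "\<not> ?thesis"
        then have "(\<Sum>j=1..q i. x i j) = 0" by (intro sum.neutral) blast
        then show False using divisionsD(2)[OF x(1) i] by simp
      qed
      then show thesis using that by blast
    qed
    then have "0 < x i j" using divisionsD(1)[OF x(1), of i j] by simp
    then have "(\<Sum>j=1..q i. g x i j) < (\<Sum>j=1..q i. p i j)"
      using le less j by (intro sum_strict_mono_ex1 bexI[of _ j]) auto
    then show False
      using divisionsD(2)[OF gx i] divisionsD(2)[OF p i] by simp
  qed
  have "g x i j = p i j" for i j
  proof (cases "i \<in> {1..m} \<and> j \<in> {1..q i}")
    case True
    \<comment> \<open>Without shortfall \<open>g x\<close> dominates \<open>p\<close> piece by
      piece; both sum to 1 over the cake, so they agree.\<close>
    have le: "p i j \<le> g x i j" for j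
      using fixed[of i j] T_zero True by (simp add: d_def)
    have "(\<Sum>j=1..q i. g x i j - p i j) = 0"
      using divisionsD(2)[OF gx] divisionsD(2)[OF p] True by (simp add: sum_subtractf)
    then have "\<forall>j\<in>{1..q i}. g x i j - p i j = 0"
      using le by (subst (asm) sum_nonneg_eq_0_iff) auto
    then show ?thesis using True by simp
  next
    case False
    then show ?thesis using divisionsD(3)[OF gx False] divisionsD(3)[OF p False] by simp
  qed
  then have "g x = p" by (intro ext)
  with x(1) show thesis by (rule that)
qed

section \<open>Partitions of unity with separated supports\<close>

definition partition_weights :: "'i set \<Rightarrow> 'a::topological_space set \<Rightarrow> ('i \<Rightarrow> 'a \<Rightarrow> real) \<Rightarrow> bool"
  where "partition_weights I P \<alpha> \<longleftrightarrow>
    (\<forall>s\<in>I. continuous_on P (\<alpha> s)) \<and> (\<forall>s\<in>I. \<forall>x\<in>P. 0 \<le> \<alpha> s x) \<and> (\<forall>x\<in>P. (\<Sum>s\<in>I. \<alpha> s x) = 1)"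

lemma partition_weightsD:
  assumes "partition_weights I P \<alpha>"
  shows "s \<in> I \<Longrightarrow> continuous_on P (\<alpha> s)"
    and "s \<in> I \<Longrightarrow> x \<in> P \<Longrightarrow> 0 \<le> \<alpha> s x"
    and "x \<in> P \<Longrightarrow> (\<Sum>s\<in>I. \<alpha> s x) = 1"
  using assms by (auto simp: partition_weights_def)

text \<open>Dividing by the positive total keeps zeros in place, and every support condition used
  later is expressed through such zeros.\<close>

lemma normalize_weights:
  fixes \<phi> :: "'i \<Rightarrow> 'a::topological_space \<Rightarrow> real"
  assumes fin: "finite I"
    and cont: "\<And>s. s \<in> I \<Longrightarrow> continuous_on P (\<phi> s)"
    and nonneg: "\<And>s x. s \<in> I \<Longrightarrow> x \<in> P \<Longrightarrow> 0 \<le> \<phi> s x"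
    and pos: "\<And>x. x \<in> P \<Longrightarrow> \<exists>s\<in>I. 0 < \<phi> s x"
  obtains \<alpha> :: "'i \<Rightarrow> 'a \<Rightarrow> real"
  where "partition_weights I P \<alpha>" and "\<forall>s x. \<phi> s x = 0 \<longrightarrow> \<alpha> s x = 0"
proof -
  define N where "N x = (\<Sum>s\<in>I. \<phi> s x)" for x
  have N: "0 < N x" if x: "x \<in> P" for x
  proof -
    obtain s where "s \<in> I" "0 < \<phi> s x" using pos[OF x] by blast
    then show ?thesis
      unfolding N_def using nonneg x by (intro sum_pos2[OF fin]) auto
  qed
  have Ncont: "continuous_on P N"
    unfolding N_def by (intro continuous_on_sum cont)
  have N0: "\<forall>x\<in>P. N x \<noteq> 0"
    using N by force
  show thesis
  proof (rule that[of "\<lambda>s x. \<phi> s x / N x"])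
    show "partition_weights I P (\<lambda>s x. \<phi> s x / N x)"
      unfolding partition_weights_def
    proof (intro conjI ballI)
      show "continuous_on P (\<lambda>x. \<phi> s x / N x)" if "s \<in> I" for s
        by (intro continuous_on_divide cont that Ncont N0)
      show "0 \<le> \<phi> s x / N x" if "s \<in> I" "x \<in> P" for s x
        using nonneg[OF that] N[OF that(2)] by simp
      show "(\<Sum>s\<in>I. \<phi> s x / N x) = 1" if "x \<in> P" for x
        using N[OF that] by (simp add: N_def flip: sum_divide_distrib)
    qed
  qed simp
qed

text \<open>For related \<open>s\<close> and \<open>t\<close>, the weight of \<open>s\<close> gets
  the factor \<open>max 0 (d (B t) x - d (A s) x)\<close> and the weight of \<open>t\<close> gets
  the opposite difference, so the two are never positive together. At a point of \<open>A s\<close>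
  all factors of \<open>s\<close> are positive, because \<open>A s\<close> misses every related
  closed set \<open>B t\<close>; the covers therefore keep both totals positive. The additional
  factor \<open>w s\<close> lets the caller prescribe where weights vanish.\<close>

lemma separated_partitions:
  fixes A B :: "'i \<Rightarrow> 'a::metric_space set" and w :: "'i \<Rightarrow> 'a \<Rightarrow> real"
  assumes fin: "finite I"
    and closed: "\<And>s. s \<in> I \<Longrightarrow> closed (A s)" "\<And>s. s \<in> I \<Longrightarrow> closed (B s)"
    and cover: "P \<subseteq> (\<Union>s\<in>I. A s)" "P \<subseteq> (\<Union>s\<in>I. B s)"
    and disj: "\<And>s t. s \<in> I \<Longrightarrow> t \<in> I \<Longrightarrow> R s t \<Longrightarrow> A s \<inter> B t = {}"
    and w: "\<And>s. s \<in> I \<Longrightarrow> continuous_on P (w s)"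
      "\<And>s x. s \<in> I \<Longrightarrow> x \<in> P \<Longrightarrow> 0 \<le> w s x"
    and wpos: "\<And>s x. s \<in> I \<Longrightarrow> x \<in> P \<Longrightarrow> x \<in> A s \<union> B s \<Longrightarrow> 0 < w s x"
  obtains \<alpha> \<beta> :: "'i \<Rightarrow> 'a \<Rightarrow> real"
  where "partition_weights I P \<alpha>" and "partition_weights I P \<beta>"
    and "\<forall>s x. w s x = 0 \<longrightarrow> \<alpha> s x = 0 \<and> \<beta> s x = 0"
    and "\<forall>s\<in>I. \<forall>t\<in>I. R s t \<longrightarrow> (\<forall>x. \<alpha> s x = 0 \<or> \<beta> t x = 0)"
proof -
  \<comment> \<open>\<open>infdist\<close> to the empty set is 0, so the empty set gets distance 1
    instead: \<open>dpos\<close> has to hold for it as well.\<close>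
  define d where "d C x = (if C = {} then 1 else infdist x C)" for C :: "'a set" and x
  have dcont: "continuous_on P (d C)" for C
    unfolding d_def by (cases "C = {}") (auto intro!: continuous_intros)
  have d0: "d C x = 0" if "x \<in> C" for C x
    using that by (auto simp: d_def)
  have dpos: "0 < d C x" if "closed C" "x \<notin> C" for C x
    using that by (auto simp: d_def infdist_pos_not_in_closed)
  define \<phi> where "\<phi> s x = w s x * (\<Prod>t\<in>{t\<in>I. R s t}. max 0 (d (B t) x - d (A s) x))" for s x
  define \<psi> where "\<psi> t x = w t x * (\<Prod>s\<in>{s\<in>I. R s t}. max 0 (d (A s) x - d (B t) x))" for t x
  have \<phi>pos: "\<exists>s\<in>I. 0 < \<phi> s x" if x: "x \<in> P" for x
  proof -
    obtain s where s: "s \<in> I" "x \<in> A s" using x cover by blast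
    have "0 < (\<Prod>t\<in>{t\<in>I. R s t}. max 0 (d (B t) x - d (A s) x))"
    proof (rule prod_pos)
      fix t assume "t \<in> {t\<in>I. R s t}"
      then have "x \<notin> B t" "closed (B t)" using disj s closed by blast+
      then show "0 < max 0 (d (B t) x - d (A s) x)"
        using dpos d0[OF s(2)] by force
    qed
    then have "0 < \<phi> s x" unfolding \<phi>_def using wpos s x by simp
    then show ?thesis using s by blast
  qed
  have \<psi>pos: "\<exists>t\<in>I. 0 < \<psi> t x" if x: "x \<in> P" for x
  proof -
    obtain t where t: "t \<in> I" "x \<in> B t" using x cover by blast
    have "0 < (\<Prod>s\<in>{s\<in>I. R s t}. max 0 (d (A s) x - d (B t) x))"
    proof (rule prod_pos)
      fix s assume "s \<in> {s\<in>I. R s t}"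
      then have "x \<notin> A s" "closed (A s)" using disj t closed by blast+
      then show "0 < max 0 (d (A s) x - d (B t) x)"
        using dpos d0[OF t(2)] by force
    qed
    then have "0 < \<psi> t x" unfolding \<psi>_def using wpos t x by simp
    then show ?thesis using t by blast
  qed
  have \<phi>cont: "continuous_on P (\<phi> s)" if "s \<in> I" for s
    unfolding \<phi>_def
    by (intro continuous_on_mult w(1) that continuous_on_prod continuous_on_max
        continuous_on_const continuous_on_diff dcont)
  have \<psi>cont: "continuous_on P (\<psi> t)" if "t \<in> I" for t
    unfolding \<psi>_def
    by (intro continuous_on_mult w(1) that continuous_on_prod continuous_on_max
        continuous_on_const continuous_on_diff dcont)
  have \<phi>0: "0 \<le> \<phi> s x" if "s \<in> I" "x \<in> P" for s x
    unfolding \<phi>_def using w(2)[OF that] by (intro mult_nonneg_nonneg prod_nonneg) auto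
  have \<psi>0: "0 \<le> \<psi> t x" if "t \<in> I" "x \<in> P" for t x
    unfolding \<psi>_def using w(2)[OF that] by (intro mult_nonneg_nonneg prod_nonneg) auto
  obtain \<alpha> where \<alpha>: "partition_weights I P \<alpha>" "\<forall>s x. \<phi> s x = 0 \<longrightarrow> \<alpha> s x = 0"
    by (rule normalize_weights[OF fin \<phi>cont \<phi>0 \<phi>pos])
  obtain \<beta> where \<beta>: "partition_weights I P \<beta>" "\<forall>s x. \<psi> s x = 0 \<longrightarrow> \<beta> s x = 0"
    by (rule normalize_weights[OF fin \<psi>cont \<psi>0 \<psi>pos])
  show thesis
  proof (rule that[OF \<alpha>(1) \<beta>(1)]; intro allI ballI impI)
    show "\<alpha> s x = 0 \<and> \<beta> s x = 0" if "w s x = 0" for s x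
      using that \<alpha>(2) \<beta>(2) by (simp add: \<phi>_def \<psi>_def)
    show "\<alpha> s x = 0 \<or> \<beta> t x = 0" if st: "s \<in> I" "t \<in> I" "R s t" for s t x
    \<comment> \<open>Whichever set is at least as far away as the other loses its weight at
      \<open>x\<close>: the factor belonging to the pair \<open>s\<close>, \<open>t\<close> is cut
      off at 0.\<close>
    proof (cases "d (B t) x \<le> d (A s) x")
      case True
      then have "(\<Prod>t\<in>{t\<in>I. R s t}. max 0 (d (B t) x - d (A s) x)) = 0"
        using st fin by (intro prod_zero) auto
      then show ?thesis using \<alpha>(2) by (simp add: \<phi>_def)
    next
      case False
      then have "(\<Prod>s\<in>{s\<in>I. R s t}. max 0 (d (A s) x - d (B t) x)) = 0"
        using st fin by (intro prod_zero) auto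
      then show ?thesis using \<beta>(2) by (simp add: \<psi>_def)
    qed
  qed
qed

section \<open>Separated weights with prescribed marginals\<close>

lemma finite_piece_selections: "finite (piece_selections m q)"
  unfolding piece_selections_def by (intro finite_PiE) auto

text \<open>The numbers \<open>a\<close> and \<open>b\<close> are the two players' weights at one
  common division, chosen so that their averaged marginals equal \<open>p\<close>. Such a division
  exists because the marginal map preserves faces and is hence onto. The factor 2 undoes the
  averaging.\<close>

lemma separated_mixture_with_marginals:
  fixes A B :: "(nat \<Rightarrow> nat) \<Rightarrow> (nat \<Rightarrow> nat \<Rightarrow> real) set"
  assumes card: "card (Sigma {1..m} (\<lambda>i. {1..q i})) = CARD('n::finite)"
    and p: "p \<in> divisions m q"
    and closed: "\<And>s. s \<in> piece_selections m q \<Longrightarrow> closed (A s)"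
      "\<And>s. s \<in> piece_selections m q \<Longrightarrow> closed (B s)"
    and cover: "divisions m q \<subseteq> (\<Union>s\<in>piece_selections m q. A s)"
      "divisions m q \<subseteq> (\<Union>s\<in>piece_selections m q. B s)"
    and disj: "\<And>s t. s \<in> piece_selections m q \<Longrightarrow> t \<in> piece_selections m q \<Longrightarrow>
      disjoint_selections m s t \<Longrightarrow> A s \<inter> B t = {}"
    and nonempty: "\<forall>s. \<forall>x\<in>A s \<union> B s. \<forall>i\<in>{1..m}. 0 < x i (s i)"
  obtains a b :: "(nat \<Rightarrow> nat) \<Rightarrow> real"
  where "\<forall>s\<in>piece_selections m q. 0 \<le> a s \<and> 0 \<le> b s"
    and "sum a (piece_selections m q) = 1" and "sum b (piece_selections m q) = 1"
    and "\<forall>s\<in>piece_selections m q. \<forall>t\<in>piece_selections m q.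
      disjoint_selections m s t \<longrightarrow> a s = 0 \<or> b t = 0"
    and "\<forall>i\<in>{1..m}. \<forall>j\<in>{1..q i}.
      (\<Sum>s\<in>{s\<in>piece_selections m q. s i = j}. a s + b s) = 2 * p i j"
proof -
  let ?I = "piece_selections m q" and ?D = "divisions m q"
  \<comment> \<open>The product of the selected lengths is continuous, positive wherever a player
    prefers \<open>s\<close> by \<open>nonempty\<close>, and zero as soon as \<open>s\<close>
    contains an empty piece.\<close>
  define w where "w s x = (\<Prod>i=1..m. x i (s i))" for s :: "nat \<Rightarrow> nat" and x :: "nat \<Rightarrow> nat \<Rightarrow> real"
  have wcont: "continuous_on ?D (w s)" for s
    unfolding w_def by (intro continuous_on_prod continuous_on_entry)
  have w0: "0 \<le> w s x" if "x \<in> ?D" for s x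
    unfolding w_def using divisionsD(1)[OF that] by (intro prod_nonneg) blast
  have wpos: "0 < w s x" if "x \<in> A s \<union> B s" for s x
    unfolding w_def using nonempty that by (intro prod_pos) blast
  obtain \<alpha> \<beta> where \<alpha>: "partition_weights ?I ?D \<alpha>" and \<beta>: "partition_weights ?I ?D \<beta>"
    and zero: "\<forall>s x. w s x = 0 \<longrightarrow> \<alpha> s x = 0 \<and> \<beta> s x = 0"
    and sep: "\<forall>s\<in>?I. \<forall>t\<in>?I. disjoint_selections m s t \<longrightarrow> (\<forall>x. \<alpha> s x = 0 \<or> \<beta> t x = 0)"
    by (rule separated_partitions[where P = ?D and w = w and R = "disjoint_selections m",
          OF finite_piece_selections closed cover disj wcont w0 wpos])
  note cont = partition_weightsD(1)[OF \<alpha>] partition_weightsD(1)[OF \<beta>]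
    and nonneg = partition_weightsD(2)[OF \<alpha>] partition_weightsD(2)[OF \<beta>]
    and one = partition_weightsD(3)[OF \<alpha>] partition_weightsD(3)[OF \<beta>]
  \<comment> \<open>Reading the averaged weights as a random selection, \<open>g x i j\<close> is
    the probability that piece \<open>j\<close> of cake \<open>i\<close> is selected.\<close>
  define g where "g x = (\<lambda>i j. if i \<in> {1..m} \<and> j \<in> {1..q i}
    then \<Sum>s\<in>{s\<in>?I. s i = j}. (\<alpha> s x + \<beta> s x) / 2 else 0)" for x
  have gcont: "continuous_on ?D g"
  proof (intro continuous_on_coordinatewise_then_product)
    fix i j
    show "continuous_on ?D (\<lambda>x. g x i j)"
    proof (cases "i \<in> {1..m} \<and> j \<in> {1..q i}")
      case True
      have "continuous_on ?D (\<lambda>x. \<Sum>s\<in>{s\<in>?I. s i = j}. (\<alpha> s x + \<beta> s x) / 2)"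
        by (intro continuous_on_sum continuous_on_divide continuous_on_add continuous_on_const cont)
          auto
      then show ?thesis using True by (simp add: g_def)
    next
      case False
      then have "(\<lambda>x. g x i j) = (\<lambda>x. 0)" by (auto simp: g_def)
      then show ?thesis by (simp only: continuous_on_const)
    qed
  qed
  have gmaps: "g \<in> ?D \<rightarrow> ?D"
  proof
    fix x assume x: "x \<in> ?D"
    show "g x \<in> ?D"
    proof (rule divisionsI)
      show "0 \<le> g x i j" for i j
      proof -
        have "0 \<le> (\<Sum>s\<in>{s\<in>?I. s i = j}. (\<alpha> s x + \<beta> s x) / 2)"
          using nonneg x by (intro sum_nonneg) (simp add: add_nonneg_nonneg)
        then show ?thesis unfolding g_def by argo
      qed
      show "(\<Sum>j=1..q i. g x i j) = 1" if i: "i \<in> {1..m}" for i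
      proof -
        have "(\<Sum>j=1..q i. g x i j) =
            (\<Sum>j=1..q i. \<Sum>s\<in>{s\<in>?I. s i = j}. (\<alpha> s x + \<beta> s x) / 2)"
          using i by (intro sum.cong refl) (simp add: g_def)
        \<comment> \<open>Each selection takes exactly one piece of cake \<open>i\<close>, so the
          inner sums run over the fibres of evaluation at \<open>i\<close>.\<close>
        also have "\<dots> = (\<Sum>s\<in>?I. (\<alpha> s x + \<beta> s x) / 2)"
        proof (rule sum.group)
          show "(\<lambda>s. s i) ` ?I \<subseteq> {1..q i}"
            using i unfolding piece_selections_def by blast
        qed (simp_all add: finite_piece_selections)
        also have "\<dots> = 1"
          using one[OF x] by (simp add: sum.distrib flip: sum_divide_distrib)
        finally show ?thesis .
      qed
      show "g x i j = 0" if "\<not> (i \<in> {1..m} \<and> j \<in> {1..q i})" for i j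
        using that unfolding g_def by argo
    qed
  qed
  \<comment> \<open>A selection using an empty piece has \<open>w s x = 0\<close>, hence no weight
    for either player.\<close>
  have gface: "g x i j = 0" if x: "x \<in> ?D" "x i j = 0" for x i j
  proof (cases "i \<in> {1..m}")
    case True
    have "\<alpha> s x = 0 \<and> \<beta> s x = 0" if "s i = j" for s
    proof -
      have "w s x = 0"
        unfolding w_def using True x(2) that by (intro prod_zero) auto
      then show ?thesis using zero by blast
    qed
    then have "(\<Sum>s\<in>{s\<in>?I. s i = j}. (\<alpha> s x + \<beta> s x) / 2) = 0"
      by (intro sum.neutral) auto
    then show ?thesis unfolding g_def by argo
  next
    case False
    then show ?thesis unfolding g_def by argo
  qed
  obtain x where x: "x \<in> ?D" "g x = p"
    by (rule face_preserving_surj[OF card gcont gmaps gface p])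
  have marg: "(\<Sum>s\<in>{s\<in>?I. s i = j}. \<alpha> s x + \<beta> s x) = 2 * p i j"
    if "i \<in> {1..m}" "j \<in> {1..q i}" for i j
  proof -
    have "p i j = g x i j"
      by (simp add: x(2))
    also have "\<dots> = (\<Sum>s\<in>{s\<in>?I. s i = j}. (\<alpha> s x + \<beta> s x) / 2)"
      using that by (simp add: g_def)
    finally show ?thesis
      by (simp flip: sum_divide_distrib)
  qed
  show thesis
    by (rule that[of "\<lambda>s. \<alpha> s x" "\<lambda>s. \<beta> s x"]) (use nonneg one sep marg x(1) in auto)
qed

section \<open>Disjoint selections from row and column masses\<close>

text \<open>
  Equal row masses force \<open>a\<close> in row \<open>u\<close> and \<open>b\<close> in row \<open>v \<noteq> u\<close> to be simultaneously present.
  If no two supporting elements were disjoint, each of the two pairs of opposite rows would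
  therefore lie in a single column, leaving one of the three columns without mass.
\<close>

lemma disjoint_support_elements:
  fixes a b :: "'s \<Rightarrow> real" and r c :: "'s \<Rightarrow> nat"
  assumes fin: "finite X"
    and nonneg: "\<forall>s\<in>X. 0 \<le> a s \<and> 0 \<le> b s"
    and rows: "\<forall>s\<in>X. r s \<in> {1, 2}"
    and one: "sum a X = 1" "sum b X = 1"
    and row_mass: "(\<Sum>s\<in>{s\<in>X. r s = 1}. a s + b s) = 1"
    and column_mass: "\<forall>j\<in>{1, 2, 3}. (\<Sum>s\<in>{s\<in>X. c s = j}. a s + b s) \<noteq> 0"
  obtains s t where "s \<in> X" "t \<in> X" "a s \<noteq> 0" "b t \<noteq> 0" "r s \<noteq> r t" "c s \<noteq> c t"
proof (rule ccontr)
  note found = that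
  assume "\<not> thesis"
  then have same: "c s = c t" if "s \<in> X" "t \<in> X" "a s \<noteq> 0" "b t \<noteq> 0" "r s \<noteq> r t" for s t
    using found that by blast
  define row where "row f u = sum f {s\<in>X. r s = u}" for f :: "'s \<Rightarrow> real" and u
  have split: "row f 1 + row f 2 = sum f X" for f
  proof -
    have "X = {s\<in>X. r s = 1} \<union> {s\<in>X. r s = 2}" using rows by auto
    moreover have "sum f ({s\<in>X. r s = 1} \<union> {s\<in>X. r s = 2}) = row f 1 + row f 2"
      unfolding row_def using fin by (intro sum.union_disjoint) auto
    ultimately show ?thesis by simp
  qed
  have "row a 1 + row b 1 = 1"
    using row_mass by (simp add: row_def sum.distrib)
  \<comment> \<open>Both \<open>a\<close> and \<open>b\<close> have total mass 1, so whatever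
    \<open>b\<close> lacks in one row it has in the other.\<close>
  then have balance: "row a 1 = row b 2" "row a 2 = row b 1"
    using split[of a] split[of b] one by auto
  have zero_iff: "row f u = 0 \<longleftrightarrow> (\<forall>s\<in>X. r s = u \<longrightarrow> f s = 0)"
    if "\<And>s. s \<in> X \<Longrightarrow> 0 \<le> f s" for f u
    unfolding row_def using fin that by (subst sum_nonneg_eq_0_iff) auto
  have column: "\<exists>j. (\<forall>s\<in>X. r s = u \<and> a s \<noteq> 0 \<longrightarrow> c s = j) \<and> (\<forall>t\<in>X. r t = v \<and> b t \<noteq> 0 \<longrightarrow> c t = j)"
    if uv: "u \<noteq> v" "row a u = row b v" for u v
  proof (cases "row a u = 0")
    case True
    then show ?thesis
      using zero_iff[of a u] zero_iff[of b v] nonneg uv by auto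
  next
    case False
    then obtain s0 t0 where "s0 \<in> X" "r s0 = u" "a s0 \<noteq> 0" "t0 \<in> X" "r t0 = v" "b t0 \<noteq> 0"
      using zero_iff[of a u] zero_iff[of b v] nonneg uv(2) by auto
    \<comment> \<open>By \<open>same\<close>, all of \<open>b\<close> in row \<open>v\<close> lies
      in the column of \<open>s0\<close>, and all of \<open>a\<close> in row \<open>u\<close> in the
      column of \<open>t0\<close>, which is the same column.\<close>
    then show ?thesis
      using same uv(1) by (intro exI[of _ "c s0"]) metis
  qed
  obtain j1 where j1: "\<forall>s\<in>X. r s = 1 \<and> a s \<noteq> 0 \<longrightarrow> c s = j1" "\<forall>t\<in>X. r t = 2 \<and> b t \<noteq> 0 \<longrightarrow> c t = j1"
    using column[of 1 2] balance by auto
  obtain j2 where j2: "\<forall>s\<in>X. r s = 2 \<and> a s \<noteq> 0 \<longrightarrow> c s = j2" "\<forall>t\<in>X. r t = 1 \<and> b t \<noteq> 0 \<longrightarrow> c t = j2"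
    using column[of 2 1] balance by auto
  have "\<exists>j\<in>{1, 2, 3}. j \<noteq> j1 \<and> j \<noteq> j2"
    by (cases "j1 = 1 \<or> j2 = 1"; cases "j1 = 2 \<or> j2 = 2") auto
  then obtain j where j: "j \<in> {1, 2, 3}" "j \<noteq> j1" "j \<noteq> j2" by blast
  have "a s = 0 \<and> b s = 0" if "s \<in> X" "c s = j" for s
    using rows j1 j2 j that by auto
  then have "(\<Sum>s\<in>{s\<in>X. c s = j}. a s + b s) = 0"
    by (intro sum.neutral) auto
  then show False using column_mass j(1) by blast
qed

section \<open>Reduction to two and three pieces\<close>

lemma closed_preferred_set:
  assumes "closed_preferences m k Pref" and "s \<in> piece_selections m k"
  shows "closed {x \<in> divisions m k. s \<in> Pref x}"
  using assms closed_divisions closedin_closed_trans unfolding closed_preferences_def by blast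

text \<open>Pieces beyond \<open>q i\<close> are empty at \<open>x\<close>, and a hungry player
  selects no empty piece. Thus the selections from the first \<open>q i\<close> pieces already
  suffice to cover the smaller set of divisions.\<close>

lemma preferred_in_smaller:
  assumes "preferences m k Pref" and "hungry m k Pref"
    and x: "x \<in> divisions m q" "x \<in> divisions m k" and s: "s \<in> Pref x"
  shows "s \<in> piece_selections m q"
proof -
  have "s \<in> piece_selections m k"
    using assms(1) x(2) s by (auto simp: preferences_def)
  then have ext: "s \<in> extensional {1..m}"
    by (simp add: piece_selections_def PiE_def)
  have "s i \<in> {1..q i}" if i: "i \<in> {1..m}" for i
  proof (rule ccontr)
    assume "s i \<notin> {1..q i}"
    then have "x i (s i) = 0" by (intro divisionsD(3)[OF x(1)]) simp
    moreover have "0 < x i (s i)" using assms(2) x(2) s i by (simp add: hungry_def)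
    ultimately show False by simp
  qed
  then show ?thesis
    using ext by (auto simp: piece_selections_def PiE_def)
qed

theorem theorem6:
  fixes k :: "nat \<Rightarrow> nat"
    and Pref_A Pref_B :: "(nat \<Rightarrow> nat \<Rightarrow> real) \<Rightarrow> (nat \<Rightarrow> nat) set"
  assumes "2 \<le> k 1" and "3 \<le> k 2"
    and "preferences 2 k Pref_A" and "hungry 2 k Pref_A" and "closed_preferences 2 k Pref_A"
    and "preferences 2 k Pref_B" and "hungry 2 k Pref_B" and "closed_preferences 2 k Pref_B"
  shows "\<exists>x\<in>divisions 2 k. \<exists>s_A\<in>Pref_A x. \<exists>s_B\<in>Pref_B x. disjoint_selections 2 s_A s_B"
proof (rule ccontr)
  assume contra: "\<not> ?thesis"
  have two: "{1..2} = {1, 2::nat}" by auto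
  define q :: "nat \<Rightarrow> nat" where "q i = (if i = 1 then 2 else 3)" for i
  \<comment> \<open>At this target each piece of cake 1 receives combined mass 2 * 1/2 = 1, so the
    two rows balance, and each piece of cake 2 receives 2/3, so no column is empty.\<close>
  define p :: "nat \<Rightarrow> nat \<Rightarrow> real" where
    "p = (\<lambda>i j. if i \<in> {1..2} \<and> j \<in> {1..q i} then 1 / real (q i) else 0)"
  let ?I = "piece_selections 2 q" and ?D = "divisions 2 q"
  have qk: "q i \<le> k i" if "i \<in> {1..2}" for i
  proof -
    have "i = 1 \<or> i = 2" using that two by blast
    then show ?thesis using assms(1,2) by (auto simp: q_def)
  qed
  have sub: "?D \<subseteq> divisions 2 k" by (rule divisions_mono) (rule qk)
  have selsub: "?I \<subseteq> piece_selections 2 k"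
    unfolding piece_selections_def by (intro PiE_mono) (use qk in auto)
  have p: "p \<in> ?D"
  proof (rule divisionsI)
    show "(\<Sum>j=1..q i. p i j) = 1" if "i \<in> {1..2}" for i
      using that by (simp add: p_def q_def)
  qed (auto simp: p_def)
  \<comment> \<open>The 2 + 3 pieces are the coordinates of the Euclidean space, so the numeral type
    \<open>5\<close> serves as its index type.\<close>
  have card: "card (Sigma {1..2} (\<lambda>i. {1..q i})) = CARD(5)"
  proof -
    have "card (Sigma {1..2} (\<lambda>i. {1..q i})) = (\<Sum>i\<in>{1..2}. q i)" by simp
    also have "\<dots> = 5" unfolding two by (simp add: q_def)
    finally show ?thesis by simp
  qed
  define pref_set where "pref_set Pref s = ?D \<inter> {x \<in> divisions 2 k. s \<in> Pref x}"
    for Pref :: "(nat \<Rightarrow> nat \<Rightarrow> real) \<Rightarrow> (nat \<Rightarrow> nat) set" and s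
  have closed: "closed (pref_set Pref s)"
    if "closed_preferences 2 k Pref" "s \<in> ?I" for Pref s
    unfolding pref_set_def
    using that selsub by (intro closed_Int closed_divisions closed_preferred_set) auto
  have cover: "?D \<subseteq> (\<Union>s\<in>?I. pref_set Pref s)"
    if pref: "preferences 2 k Pref" "hungry 2 k Pref" for Pref
  proof
    fix x assume x: "x \<in> ?D"
    then have xk: "x \<in> divisions 2 k" using sub by blast
    have "Pref x \<noteq> {}" using pref(1) xk by (simp add: preferences_def)
    then obtain s where s: "s \<in> Pref x" by blast
    have "s \<in> ?I" by (rule preferred_in_smaller[OF pref x xk s])
    moreover have "x \<in> pref_set Pref s" using x xk s by (simp add: pref_set_def)
    ultimately show "x \<in> (\<Union>s\<in>?I. pref_set Pref s)" by blast
  qed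
  have disj: "pref_set Pref_A s \<inter> pref_set Pref_B t = {}"
    if "s \<in> ?I" "t \<in> ?I" "disjoint_selections 2 s t" for s t
    using contra that unfolding pref_set_def by blast
  have nonempty: "\<forall>s. \<forall>x\<in>pref_set Pref_A s \<union> pref_set Pref_B s. \<forall>i\<in>{1..2}. 0 < x i (s i)"
    using assms(4,7) unfolding pref_set_def hungry_def by blast
  obtain a b where nonneg: "\<forall>s\<in>?I. 0 \<le> a s \<and> 0 \<le> b s"
    and one: "sum a ?I = 1" "sum b ?I = 1"
    and sep: "\<forall>s\<in>?I. \<forall>t\<in>?I. disjoint_selections 2 s t \<longrightarrow> a s = 0 \<or> b t = 0"
    and marg: "\<forall>i\<in>{1..2}. \<forall>j\<in>{1..q i}. (\<Sum>s\<in>{s\<in>?I. s i = j}. a s + b s) = 2 * p i j"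
    by (rule separated_mixture_with_marginals[where A = "pref_set Pref_A" and B = "pref_set Pref_B"
          and m = 2 and q = q and p = p, OF card p closed[OF assms(5)] closed[OF assms(8)]
          cover[OF assms(3,4)] cover[OF assms(6,7)] disj nonempty])
  have rows: "\<forall>s\<in>?I. s 1 \<in> {1, 2}"
    by (force simp: piece_selections_def PiE_def Pi_def q_def)
  have row: "(\<Sum>s\<in>{s\<in>?I. s 1 = 1}. a s + b s) = 1"
    using bspec[OF bspec[OF marg, of 1], of 1] by (simp add: p_def q_def)
  have columns: "\<forall>j\<in>{1, 2, 3}. (\<Sum>s\<in>{s\<in>?I. s 2 = j}. a s + b s) \<noteq> 0"
  proof
    fix j :: nat assume "j \<in> {1, 2, 3}"
    then show "(\<Sum>s\<in>{s\<in>?I. s 2 = j}. a s + b s) \<noteq> 0"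
      using bspec[OF bspec[OF marg, of 2], of j] by (auto simp: p_def q_def)
  qed
  obtain s t where st: "s \<in> ?I" "t \<in> ?I" "a s \<noteq> 0" "b t \<noteq> 0" "s 1 \<noteq> t 1" "s 2 \<noteq> t 2"
    by (rule disjoint_support_elements[of ?I a b "\<lambda>s. s 1" "\<lambda>s. s 2",
          OF finite_piece_selections nonneg rows one row columns])
  then have "disjoint_selections 2 s t"
    unfolding disjoint_selections_def two by simp
  then show False
    using sep st by blast
qed

end
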